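(* Let $f\colon P\to Q$ be a surjective quandle homomorphism. Then $f$ is homogeneous if and only if there is some subgroup $G\subseteq\mathrm{Aut}(P)$ normalized by $\mathrm{Inn}(P)$ such that $f$ is isomorphic to the quotient map $\pi_G\colon P\to P/G$ as quotients of $P$.
   Context: A quandle is a set $Q$ with bijections $s_x\colon Q\to Q$ ($x\in Q$) such that $s_x(x)=x$ and $s_x\circ s_y=s_{s_x(y)}\circ s_x$ for all $x,y\in Q$. A quandle homomorphism $f\colon P\to Q$ is a map with $f(s_x(y))=s_{f(x)}(f(y))$ for all $x,y\in P$. $\mathrm{Aut}(P)$ is the group of bijective quandle endomorphisms of $P$, and $\mathrm{Inn}(P)\subseteq\mathrm{Aut}(P)$ is the subgroup generated by all $s_x$, $x\in P$. The relative automorphism group of $f$ is $\mathrm{Aut}_{\mathrm{rel}}(f)=\{\varphi\in\mathrm{Aut}(P)\mid f\circ\varphi=f\}$. The homomorphism $f$ is homogeneous if it is surjective and for each $q\in Q$ the group $\mathrm{Aut}_{\mathrm{rel}}(f)$ acts transitively on $f^{-1}(q)$. A subgroup $G\subseteq\mathrm{Aut}(P)$ is normalized by $\mathrm{Inn}(P)$ if $\varphi G\varphi^{-1}\subseteq G$ for all $\varphi\in\mathrm{Inn}(P)$; in that case the set $P/G$ of $G$-orbits has a well-defined quandle structure $s_{[x]}([y])=[s_x(y)]$, and $\pi_G\colon P\to P/G$ is the natural quotient homomorphism. Two surjective homomorphisms $f\colon P\to Q$ and $f'\colon P\to Q'$ are isomorphic as quotients of $P$ if there is a quandle isomorphism $\theta\colon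 Q\to Q'$ with $\theta\circ f=f'$. *)

theory Defs
  imports "HOL-Algebra.Group_Action" "HOL-Algebra.Generated_Groups"
begin

section \<open>Quandles\<close>

text \<open>The term \<open>x \<rhd>\<^bsub>Q\<^esub> y\<close> stands for $s_x(y)$. Only the values on the carrier matter.\<close>

record 'a quandle = "'a partial_object" +
  qop :: "['a, 'a] \<Rightarrow> 'a" (infixr \<open>\<rhd>\<index>\<close> 70)

locale quandle =
  fixes Q :: "('a, 'm) quandle_scheme" (structure)
  assumes bij: "x \<in> carrier Q \<Longrightarrow> bij_betw (\<lambda>y. x \<rhd> y) (carrier Q) (carrier Q)"
    and idem: "x \<in> carrier Q \<Longrightarrow> x \<rhd> x = x"
    and distrib: "\<lbrakk>x \<in> carrier Q; y \<in> carrier Q; z \<in> carrier Q\<rbrakk>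
      \<Longrightarrow> x \<rhd> (y \<rhd> z) = (x \<rhd> y) \<rhd> (x \<rhd> z)"

definition qhom :: "('a, 'm) quandle_scheme \<Rightarrow> ('b, 'n) quandle_scheme \<Rightarrow> ('a \<Rightarrow> 'b) set"
  where "qhom P Q = {f \<in> carrier P \<rightarrow> carrier Q.
    \<forall>x \<in> carrier P. \<forall>y \<in> carrier P. f (x \<rhd>\<^bsub>P\<^esub> y) = f x \<rhd>\<^bsub>Q\<^esub> f y}"

definition qiso :: "('a, 'm) quandle_scheme \<Rightarrow> ('b, 'n) quandle_scheme \<Rightarrow> ('a \<Rightarrow> 'b) set"
  where "qiso P Q = {f \<in> qhom P Q. bij_betw f (carrier P) (carrier Q)}"


section \<open>Automorphism groups\<close>

text \<open>As for \<open>auto\<close> and \<open>AutoGroup\<close> in \<open>HOL-Algebra\<close>, automorphisms are made extensional, so that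
  they are determined by their values on the carrier.\<close>

definition qaut :: "('a, 'm) quandle_scheme \<Rightarrow> ('a \<Rightarrow> 'a) set"
  where "qaut P = qhom P P \<inter> Bij (carrier P)"

definition Aut :: "('a, 'm) quandle_scheme \<Rightarrow> ('a \<Rightarrow> 'a) monoid"
  where "Aut P = BijGroup (carrier P) \<lparr>carrier := qaut P\<rparr>"

definition Inn :: "('a, 'm) quandle_scheme \<Rightarrow> ('a \<Rightarrow> 'a) set"
  where "Inn P = generate (Aut P) ((\<lambda>x. \<lambda>y \<in> carrier P. x \<rhd>\<^bsub>P\<^esub> y) ` carrier P)"

definition Aut_rel :: "('a, 'm) quandle_scheme \<Rightarrow> ('a \<Rightarrow> 'b) \<Rightarrow> ('a \<Rightarrow> 'a) set"
  where "Aut_rel P f = {\<phi> \<in> carrier (Aut P). \<forall>x \<in> carrier P. f (\<phi> x) = f x}"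

definition fiber :: "('a, 'm) quandle_scheme \<Rightarrow> ('a \<Rightarrow> 'b) \<Rightarrow> 'b \<Rightarrow> 'a set"
  where "fiber P f q = {x \<in> carrier P. f x = q}"

text \<open>The action on a fiber is by restriction of automorphisms to it, since \<open>BijGroup\<close> asks for
  functions that are extensional on the fiber.\<close>

definition homogeneous ::
    "('a, 'm) quandle_scheme \<Rightarrow> ('b, 'n) quandle_scheme \<Rightarrow> ('a \<Rightarrow> 'b) \<Rightarrow> bool"
  where "homogeneous P Q f \<longleftrightarrow> f \<in> qhom P Q \<and> f ` carrier P = carrier Q \<and>
    (\<forall>q \<in> carrier Q. transitive_action (Aut P \<lparr>carrier := Aut_rel P f\<rparr>) (fiber P f q)
       (\<lambda>\<phi>. restrict \<phi> (fiber P f q)))"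


section \<open>Quotients by groups of automorphisms\<close>

definition normalized_by_Inn :: "('a, 'm) quandle_scheme \<Rightarrow> ('a \<Rightarrow> 'a) set \<Rightarrow> bool"
  where "normalized_by_Inn P G \<longleftrightarrow>
    (\<forall>\<phi> \<in> Inn P. \<phi> <#\<^bsub>Aut P\<^esub> G #>\<^bsub>Aut P\<^esub> inv\<^bsub>Aut P\<^esub> \<phi> \<subseteq> G)"

definition quot_map :: "('a, 'm) quandle_scheme \<Rightarrow> ('a \<Rightarrow> 'a) set \<Rightarrow> 'a \<Rightarrow> 'a set"
  where "quot_map P G x = orbit (Aut P \<lparr>carrier := G\<rparr>) (\<lambda>\<phi>. \<phi>) x"

text \<open>The operation on orbits collects \<open>[x \<rhd> y]\<close> over all choices of representatives; for \<open>G\<close>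
  normalized by \<open>Inn P\<close> these classes coincide, see \<open>quot_op\<close> below.\<close>

definition quot :: "('a, 'm) quandle_scheme \<Rightarrow> ('a \<Rightarrow> 'a) set \<Rightarrow> 'a set quandle"
  where "quot P G =
    \<lparr>carrier = orbits (Aut P \<lparr>carrier := G\<rparr>) (carrier P) (\<lambda>\<phi>. \<phi>),
     qop = \<lambda>A B. \<Union>x \<in> A. \<Union>y \<in> B. quot_map P G (x \<rhd>\<^bsub>P\<^esub> y)\<rparr>"

definition iso_as_quotients :: "('a, 'm) quandle_scheme \<Rightarrow>
    ('a \<Rightarrow> 'b) \<Rightarrow> ('b, 'n) quandle_scheme \<Rightarrow> ('a \<Rightarrow> 'c) \<Rightarrow> ('c, 'k) quandle_scheme \<Rightarrow> bool"
  where "iso_as_quotients P f Q f' Q' \<longleftrightarrow>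
    (\<exists>\<theta> \<in> qiso Q Q'. \<forall>x \<in> carrier P. \<theta> (f x) = f' x)"


section \<open>Well-definedness\<close>

context quandle
begin

lemma closed [simp]: "x \<in> carrier Q \<Longrightarrow> y \<in> carrier Q \<Longrightarrow> x \<rhd> y \<in> carrier Q"
  using bij bij_betwE by blast

lemma qaut_closed: "g \<in> qaut Q \<Longrightarrow> x \<in> carrier Q \<Longrightarrow> g x \<in> carrier Q"
  by (auto simp: qaut_def qhom_def)

lemma subgroup_qaut: "subgroup (qaut Q) (BijGroup (carrier Q))"
proof (rule subgroup.intro)
  show "qaut Q \<subseteq> carrier (BijGroup (carrier Q))"
    by (auto simp: qaut_def BijGroup_def)
next
  fix g h assume "g \<in> qaut Q" "h \<in> qaut Q"
  then show "g \<otimes>\<^bsub>BijGroup (carrier Q)\<^esub> h \<in> qaut Q"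
    using compose_Bij[of g "carrier Q" h]
    by (auto simp: qaut_def BijGroup_def qhom_def compose_eq Pi_iff)
next
  show "\<one>\<^bsub>BijGroup (carrier Q)\<^esub> \<in> qaut Q"
    by (auto simp: qaut_def BijGroup_def id_Bij qhom_def)
next
  fix g assume g: "g \<in> qaut Q"
  then have B: "g \<in> Bij (carrier Q)" by (simp add: qaut_def)
  have "inv_into (carrier Q) g (x \<rhd> y) = inv_into (carrier Q) g x \<rhd> inv_into (carrier Q) g y"
    if "x \<in> carrier Q" "y \<in> carrier Q" for x y
    using g B that by (intro Bij_inv_into_lemma) (auto simp: qaut_def qhom_def)
  then show "inv\<^bsub>BijGroup (carrier Q)\<^esub> g \<in> qaut Q"
    using B by (auto simp: inv_BijGroup qaut_def restrict_inv_into_Bij qhom_def Bij_inv_into_mem)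
qed

lemma group_Aut: "group (Aut Q)"
  by (simp add: Aut_def subgroup.subgroup_is_group subgroup_qaut group_BijGroup)

lemma carrier_Aut [simp]: "carrier (Aut Q) = qaut Q"
  by (simp add: Aut_def)

lemma one_Aut: "\<one>\<^bsub>Aut Q\<^esub> = (\<lambda>x \<in> carrier Q. x)"
  by (simp add: Aut_def BijGroup_def)

lemma mult_Aut: "g \<in> qaut Q \<Longrightarrow> h \<in> qaut Q \<Longrightarrow> g \<otimes>\<^bsub>Aut Q\<^esub> h = compose (carrier Q) g h"
  by (simp add: Aut_def BijGroup_def qaut_def)

lemma mult_Aut_app:
  "g \<in> qaut Q \<Longrightarrow> h \<in> qaut Q \<Longrightarrow> x \<in> carrier Q \<Longrightarrow> (g \<otimes>\<^bsub>Aut Q\<^esub> h) x = g (h x)"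
  by (simp add: mult_Aut compose_def)

lemma inv_Aut_app:
  assumes "g \<in> qaut Q" "x \<in> carrier Q"
  shows "(inv\<^bsub>Aut Q\<^esub> g) (g x) = x" "g ((inv\<^bsub>Aut Q\<^esub> g) x) = x" "(inv\<^bsub>Aut Q\<^esub> g) x \<in> carrier Q"
proof -
  interpret A: group "Aut Q" by (rule group_Aut)
  have i: "inv\<^bsub>Aut Q\<^esub> g \<in> qaut Q" using A.inv_closed[of g] assms by simp
  show "(inv\<^bsub>Aut Q\<^esub> g) (g x) = x"
    using A.l_inv[of g] mult_Aut_app[OF i assms(1,2)] assms by (simp add: one_Aut)
  show "g ((inv\<^bsub>Aut Q\<^esub> g) x) = x"
    using A.r_inv[of g] mult_Aut_app[OF assms(1) i assms(2)] assms by (simp add: one_Aut)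
  show "(inv\<^bsub>Aut Q\<^esub> g) x \<in> carrier Q" using i assms(2) qaut_closed by blast
qed

lemma inner_qaut: "x \<in> carrier Q \<Longrightarrow> (\<lambda>y \<in> carrier Q. x \<rhd> y) \<in> qaut Q"
  using bij[of x] by (auto simp: qaut_def qhom_def Bij_def distrib[symmetric])

lemma subgroup_Inn: "subgroup (Inn Q) (Aut Q)"
  unfolding Inn_def using inner_qaut by (intro group.generate_is_subgroup group_Aut) auto

lemma subgroup_Aut_rel: "subgroup (Aut_rel Q f) (Aut Q)"
proof (rule group.subgroupI[OF group_Aut])
  interpret A: group "Aut Q" by (rule group_Aut)
  show "Aut_rel Q f \<subseteq> carrier (Aut Q)" by (auto simp: Aut_rel_def)
  have "\<one>\<^bsub>Aut Q\<^esub> \<in> Aut_rel Q f"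
    using A.one_closed by (simp add: Aut_rel_def one_Aut)
  then show "Aut_rel Q f \<noteq> {}" by blast
  fix g assume g: "g \<in> Aut_rel Q f"
  have "f ((inv\<^bsub>Aut Q\<^esub> g) x) = f x" if "x \<in> carrier Q" for x
  proof -
    have "g \<in> qaut Q" and fg: "\<And>y. y \<in> carrier Q \<Longrightarrow> f (g y) = f y"
      using g by (auto simp: Aut_rel_def)
    then show ?thesis using inv_Aut_app[of g x] that fg[of "(inv\<^bsub>Aut Q\<^esub> g) x"] by simp
  qed
  then show "inv\<^bsub>Aut Q\<^esub> g \<in> Aut_rel Q f"
    using g A.inv_closed[of g] by (auto simp: Aut_rel_def)
  fix h assume "h \<in> Aut_rel Q f"
  then show "g \<otimes>\<^bsub>Aut Q\<^esub> h \<in> Aut_rel Q f"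
    using g A.m_closed[of g h] by (auto simp: Aut_rel_def mult_Aut_app qaut_closed)
qed

lemma fiber_action:
  "group_action (Aut Q \<lparr>carrier := Aut_rel Q f\<rparr>) (fiber Q f q) (\<lambda>\<phi>. restrict \<phi> (fiber Q f q))"
proof -
  interpret A: group "Aut Q" by (rule group_Aut)
  let ?F = "fiber Q f q"
  have B: "restrict g ?F \<in> Bij ?F" if g: "g \<in> Aut_rel Q f" for g
  proof -
    have gq: "g \<in> qaut Q" using g by (simp add: Aut_rel_def)
    have i: "inv\<^bsub>Aut Q\<^esub> g \<in> Aut_rel Q f" using subgroup_Aut_rel g by (rule subgroup.m_inv_closed)
    have "bij_betw g ?F ?F"
      by (rule bij_betw_byWitness[where f' = "inv\<^bsub>Aut Q\<^esub> g"])
        (use g i gq in \<open>auto simp: fiber_def Aut_rel_def inv_Aut_app qaut_closed\<close>)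
    then show ?thesis by (simp add: Bij_def)
  qed
  have "(\<lambda>\<phi>. restrict \<phi> ?F) \<in> hom (Aut Q \<lparr>carrier := Aut_rel Q f\<rparr>) (BijGroup ?F)"
  proof (rule homI)
    fix g h assume "g \<in> carrier (Aut Q \<lparr>carrier := Aut_rel Q f\<rparr>)"
      "h \<in> carrier (Aut Q \<lparr>carrier := Aut_rel Q f\<rparr>)"
    then have gh: "g \<in> Aut_rel Q f" "h \<in> Aut_rel Q f" by simp_all
    then show "restrict (g \<otimes>\<^bsub>Aut Q \<lparr>carrier := Aut_rel Q f\<rparr>\<^esub> h) ?F
        = restrict g ?F \<otimes>\<^bsub>BijGroup ?F\<^esub> restrict h ?F"
      using B by (auto simp: BijGroup_def compose_def fun_eq_iff fiber_def Aut_rel_def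
          mult_Aut_app qaut_closed)
  qed (use B in \<open>simp add: BijGroup_def\<close>)
  then show ?thesis
    by (intro group_action.intro group_hom.intro group_hom_axioms.intro
        A.subgroup_imp_group[OF subgroup_Aut_rel] group_BijGroup)
qed

lemma orbit_action:
  assumes "subgroup G (Aut Q)"
  shows "group_action (Aut Q \<lparr>carrier := G\<rparr>) (carrier Q) (\<lambda>\<phi>. \<phi>)"
proof -
  interpret A: group "Aut Q" by (rule group_Aut)
  have "G \<subseteq> qaut Q" using subgroup.subset[OF assms] by simp
  then have "(\<lambda>\<phi>. \<phi>) \<in> hom (Aut Q \<lparr>carrier := G\<rparr>) (BijGroup (carrier Q))"
    by (auto simp: hom_def Aut_def BijGroup_def qaut_def)
  then show ?thesis
    by (intro group_action.intro group_hom.intro group_hom_axioms.intro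
        A.subgroup_imp_group[OF assms] group_BijGroup)
qed

lemma quot_map_eq: "quot_map Q G x = {g x | g. g \<in> G}"
  by (simp add: quot_map_def orbit_def)

context
  fixes G
  assumes G: "subgroup G (Aut Q)" and nrm: "normalized_by_Inn Q G"
begin

lemma quot_map_cong_iff:
  assumes "x \<in> carrier Q" "y \<in> carrier Q"
  shows "quot_map Q G x = quot_map Q G y \<longleftrightarrow> (\<exists>g \<in> G. y = g x)"
proof -
  interpret A: group "Aut Q" by (rule group_Aut)
  note GA = subgroup.subset[OF G]
  have sub: "quot_map Q G (g x) \<subseteq> quot_map Q G x" if "g \<in> G" "x \<in> carrier Q" for g x
  proof -
    have "h (g x) = (h \<otimes>\<^bsub>Aut Q\<^esub> g) x" "h \<otimes>\<^bsub>Aut Q\<^esub> g \<in> G" if "h \<in> G" for h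
      using that \<open>g \<in> G\<close> \<open>x \<in> carrier Q\<close> GA
      by (auto simp: mult_Aut_app subset_iff subgroup.m_closed[OF G])
    then show ?thesis unfolding quot_map_eq by blast
  qed
  show ?thesis
  proof
    assume "quot_map Q G x = quot_map Q G y"
    moreover have "y \<in> quot_map Q G y"
      using subgroup.one_closed[OF G] assms unfolding quot_map_eq one_Aut
      by (auto intro!: exI[of _ "\<lambda>x \<in> carrier Q. x"])
    ultimately show "\<exists>g \<in> G. y = g x" by (auto simp: quot_map_eq)
  next
    assume "\<exists>g \<in> G. y = g x"
    then obtain g where g: "g \<in> G" "y = g x" by blast
    then have "x = (inv\<^bsub>Aut Q\<^esub> g) y" "inv\<^bsub>Aut Q\<^esub> g \<in> G"
      using GA assms by (auto simp: inv_Aut_app subset_iff subgroup.m_inv_closed[OF G])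
    then show "quot_map Q G x = quot_map Q G y"
      using sub g assms by (metis subset_antisym)
  qed
qed

lemma conj_closed:
  assumes "\<phi> \<in> Inn Q" "g \<in> G"
  shows "\<phi> \<otimes>\<^bsub>Aut Q\<^esub> g \<otimes>\<^bsub>Aut Q\<^esub> inv\<^bsub>Aut Q\<^esub> \<phi> \<in> G"
  using nrm assms unfolding normalized_by_Inn_def l_coset_def r_coset_def by blast

lemma Inn_swap:
  assumes "\<phi> \<in> Inn Q" "g \<in> G" "x \<in> carrier Q"
  shows "\<exists>h \<in> G. \<phi> (g x) = h (\<phi> x)"
proof -
  interpret A: group "Aut Q" by (rule group_Aut)
  have q: "\<phi> \<in> qaut Q" "g \<in> qaut Q" "inv\<^bsub>Aut Q\<^esub> \<phi> \<in> qaut Q" "\<phi> \<otimes>\<^bsub>Aut Q\<^esub> g \<in> qaut Q"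
    using assms subgroup.subset[OF subgroup_Inn] subgroup.subset[OF G] A.inv_closed[of \<phi>]
      A.m_closed[of \<phi> g] by auto
  have "(\<phi> \<otimes>\<^bsub>Aut Q\<^esub> g \<otimes>\<^bsub>Aut Q\<^esub> inv\<^bsub>Aut Q\<^esub> \<phi>) (\<phi> x) = \<phi> (g x)"
    using q assms(3) by (simp add: mult_Aut_app qaut_closed inv_Aut_app)
  then show ?thesis using conj_closed[OF assms(1,2)] by metis
qed

lemma op_swap:
  assumes "x \<in> carrier Q" "g \<in> G" "y \<in> carrier Q"
  shows "\<exists>h \<in> G. x \<rhd> g y = h (x \<rhd> y)"
proof -
  have "(\<lambda>y \<in> carrier Q. x \<rhd> y) \<in> Inn Q"
    using assms(1) unfolding Inn_def by (intro generate.incl) blast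
  moreover have "g y \<in> carrier Q"
    using assms subgroup.subset[OF G] qaut_closed by auto
  ultimately show ?thesis using Inn_swap[of _ g y] assms by fastforce
qed

lemma quot_op:
  assumes x: "x \<in> carrier Q" and y: "y \<in> carrier Q"
  shows "quot_map Q G x \<rhd>\<^bsub>quot Q G\<^esub> quot_map Q G y = quot_map Q G (x \<rhd> y)"
proof -
  interpret A: group "Aut Q" by (rule group_Aut)
  have GA: "G \<subseteq> qaut Q" using subgroup.subset[OF G] by simp
  have c: "quot_map Q G (g x \<rhd> h y) = quot_map Q G (x \<rhd> y)" if g: "g \<in> G" and h: "h \<in> G" for g h
  proof -
    let ?k = "inv\<^bsub>Aut Q\<^esub> g \<otimes>\<^bsub>Aut Q\<^esub> h"
    have ig: "inv\<^bsub>Aut Q\<^esub> g \<in> G" and k: "?k \<in> G"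
      using subgroup.m_inv_closed[OF G] subgroup.m_closed[OF G] g h by auto
    have c: "h y \<in> carrier Q" "?k y \<in> carrier Q" "g x \<in> carrier Q"
      using GA g h k x y qaut_closed by blast+
    have "?k y = (inv\<^bsub>Aut Q\<^esub> g) (h y)" using GA ig h y by (intro mult_Aut_app) auto
    then have "g (?k y) = h y" using GA g c by (simp add: inv_Aut_app subset_iff)
    moreover have "g \<in> qhom Q Q" using GA g by (auto simp: qaut_def)
    ultimately have "g x \<rhd> h y = g (x \<rhd> ?k y)"
      using x c by (simp add: qhom_def)
    moreover obtain k' where k': "k' \<in> G" "x \<rhd> ?k y = k' (x \<rhd> y)"
      using op_swap[OF x k y] by blast
    moreover have "x \<rhd> ?k y \<in> carrier Q" using x c by simp
    ultimately show ?thesis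
      using g k' x y c quot_map_cong_iff by (metis closed)
  qed
  have *: "quot_map Q G x = (\<lambda>g. g x) ` G" "quot_map Q G y = (\<lambda>g. g y) ` G"
    by (auto simp: quot_map_eq)
  have "G \<noteq> {}" using subgroup.one_closed[OF G] by blast
  then show ?thesis
    by (subst quot_def) (simp add: * image_image c cong: SUP_cong)
qed

lemma carrier_quot: "carrier (quot Q G) = quot_map Q G ` carrier Q"
  by (auto simp: quot_def orbits_def quot_map_def)

lemma quot_map_hom: "quot_map Q G \<in> qhom Q (quot Q G)"
  by (auto simp: qhom_def carrier_quot quot_op)

lemma quandle_quot: "quandle (quot Q G)"
proof
  interpret A: group "Aut Q" by (rule group_Aut)
  fix X assume "X \<in> carrier (quot Q G)"
  then obtain x where x: "x \<in> carrier Q" "X = quot_map Q G x" by (auto simp: carrier_quot)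
  then show "X \<rhd>\<^bsub>quot Q G\<^esub> X = X" by (simp add: quot_op idem)
  let ?s = "\<lambda>y \<in> carrier Q. x \<rhd> y"
  let ?t = "inv\<^bsub>Aut Q\<^esub> ?s"
  have s: "?s \<in> Inn Q" "?s \<in> qaut Q"
    using x inner_qaut unfolding Inn_def by (auto intro: generate.incl)
  have t: "?t \<in> Inn Q" using s(1) subgroup.m_inv_closed[OF subgroup_Inn] by blast
  have ts: "?t (x \<rhd> y) = y" if "y \<in> carrier Q" for y
    using inv_Aut_app(1)[OF s(2) that] that by simp
  show "bij_betw (\<lambda>Y. X \<rhd>\<^bsub>quot Q G\<^esub> Y) (carrier (quot Q G)) (carrier (quot Q G))"
    unfolding bij_betw_def
  proof
    show "inj_on (\<lambda>Y. X \<rhd>\<^bsub>quot Q G\<^esub> Y) (carrier (quot Q G))"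
    proof (rule inj_onI)
      fix Y Z assume "Y \<in> carrier (quot Q G)" "Z \<in> carrier (quot Q G)"
        and e: "X \<rhd>\<^bsub>quot Q G\<^esub> Y = X \<rhd>\<^bsub>quot Q G\<^esub> Z"
      then obtain y z where yz: "y \<in> carrier Q" "z \<in> carrier Q"
        "Y = quot_map Q G y" "Z = quot_map Q G z" by (auto simp: carrier_quot)
      then have "quot_map Q G (x \<rhd> y) = quot_map Q G (x \<rhd> z)" using e x by (simp add: quot_op)
      then obtain g where "g \<in> G" "x \<rhd> z = g (x \<rhd> y)"
        using quot_map_cong_iff x yz by auto
      then show "Y = Z"
        using Inn_swap[OF t, of g "x \<rhd> y"] x yz ts quot_map_cong_iff by (metis closed)
    qed
    show "(\<lambda>Y. X \<rhd>\<^bsub>quot Q G\<^esub> Y) ` carrier (quot Q G) = carrier (quot Q G)"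
    proof -
      have "(\<lambda>y. x \<rhd> y) ` carrier Q = carrier Q" using bij[OF x(1)] by (simp add: bij_betw_def)
      then have "quot_map Q G ` (\<lambda>y. x \<rhd> y) ` carrier Q = quot_map Q G ` carrier Q" by simp
      then show ?thesis using x by (simp add: carrier_quot image_image quot_op cong: image_cong)
    qed
  qed
  fix Y Z assume "Y \<in> carrier (quot Q G)" "Z \<in> carrier (quot Q G)"
  then show "X \<rhd>\<^bsub>quot Q G\<^esub> (Y \<rhd>\<^bsub>quot Q G\<^esub> Z) =
      (X \<rhd>\<^bsub>quot Q G\<^esub> Y) \<rhd>\<^bsub>quot Q G\<^esub> (X \<rhd>\<^bsub>quot Q G\<^esub> Z)"
    using x by (auto simp: carrier_quot quot_op distrib[symmetric])
qed

end

end

end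

theory Submission
  imports Defs
begin

text \<open>Both homogeneity and being isomorphic to a quotient by \<open>G\<close> are statements about the kernel pair
  of \<open>f\<close>: the first says that it is the orbit relation of \<open>Aut_rel P f\<close>, the second that it is the
  orbit relation of \<open>G\<close>. In the latter case \<open>G \<subseteq> Aut_rel P f\<close>, so \<open>Aut_rel P f\<close> is transitive on
  fibers as well. Conversely \<open>G = Aut_rel P f\<close> qualifies, since inner automorphisms of \<open>P\<close>
  preserve the kernel pair of any homomorphism.\<close>

text \<open>An isomorphism \<open>\<theta>\<close> compatible with both maps is forced to send
  \<open>f x\<close> to \<open>f' x\<close>. Equality of the kernel pairs is exactly what makes this
  rule well defined and injective; surjectivity of \<open>f'\<close> makes it onto, and that of
  \<open>f\<close> carries the homomorphism law down from \<open>P\<close>.\<close>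

lemma iso_as_quotients_iff:
  assumes f: "f \<in> qhom P Q" "f ` carrier P = carrier Q"
    and f': "f' \<in> qhom P Q'" "f' ` carrier P = carrier Q'"
    and closed: "\<And>x y. x \<in> carrier P \<Longrightarrow> y \<in> carrier P \<Longrightarrow> x \<rhd>\<^bsub>P\<^esub> y \<in> carrier P"
  shows "iso_as_quotients P f Q f' Q' \<longleftrightarrow>
    (\<forall>x \<in> carrier P. \<forall>y \<in> carrier P. f x = f y \<longleftrightarrow> f' x = f' y)"
proof
  assume "iso_as_quotients P f Q f' Q'"
  then obtain \<theta> where \<theta>: "\<theta> \<in> qiso Q Q'" "\<And>x. x \<in> carrier P \<Longrightarrow> \<theta> (f x) = f' x"
    by (auto simp: iso_as_quotients_def)
  then have "inj_on \<theta> (carrier Q)" by (simp add: qiso_def bij_betw_def)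
  then show "\<forall>x \<in> carrier P. \<forall>y \<in> carrier P. f x = f y \<longleftrightarrow> f' x = f' y"
    using \<theta>(2) f(2) by (metis imageI inj_onD)
next
  assume ker: "\<forall>x \<in> carrier P. \<forall>y \<in> carrier P. f x = f y \<longleftrightarrow> f' x = f' y"
  \<comment> \<open>A preimage under \<open>f\<close> is chosen arbitrarily; by \<open>ker\<close>
    the value of \<open>f'\<close> does not depend on the choice.\<close>
  define \<theta> where "\<theta> q = f' (inv_into (carrier P) f q)" for q
  have \<theta>: "\<theta> (f x) = f' x" if "x \<in> carrier P" for x
  proof -
    have "f (inv_into (carrier P) f (f x)) = f x" "inv_into (carrier P) f (f x) \<in> carrier P"
      using that by (simp_all add: f_inv_into_f inv_into_into)
    then show ?thesis using that ker unfolding \<theta>_def by blast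
  qed
  have "\<theta> \<in> qhom Q Q'"
    \<comment> \<open>With \<open>carrier Q\<close> written as an image, every element comes with a
      preimage, where the values of \<open>\<theta>\<close> are known.\<close>
    unfolding qhom_def f(2)[symmetric]
  proof (intro CollectI conjI ballI)
    show "\<theta> \<in> f ` carrier P \<rightarrow> carrier Q'" using f'(2) by (auto simp: \<theta>)
    fix u v assume "u \<in> f ` carrier P" "v \<in> f ` carrier P"
    then obtain x y where xy: "x \<in> carrier P" "y \<in> carrier P" "u = f x" "v = f y" by blast
    then have "f x \<rhd>\<^bsub>Q\<^esub> f y = f (x \<rhd>\<^bsub>P\<^esub> y)" using f(1) by (simp add: qhom_def)
    then show "\<theta> (u \<rhd>\<^bsub>Q\<^esub> v) = \<theta> u \<rhd>\<^bsub>Q'\<^esub> \<theta> v"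
      using xy f'(1) by (simp add: \<theta> closed qhom_def)
  qed
  moreover have "bij_betw \<theta> (carrier Q) (carrier Q')"
    unfolding bij_betw_def
  proof
    \<comment> \<open>Well-definedness used one direction of \<open>ker\<close>; this is the
      other.\<close>
    show "inj_on \<theta> (carrier Q)"
      using ker by (auto simp: inj_on_def \<theta> simp flip: f(2))
    show "\<theta> ` carrier Q = carrier Q'"
      by (simp add: image_image \<theta> flip: f(2) f'(2))
  qed
  ultimately show "iso_as_quotients P f Q f' Q'"
    using \<theta> by (auto simp: iso_as_quotients_def qiso_def)
qed

context quandle
begin

text \<open>Ranging over all fibers and over pairs inside each of them amounts to ranging over the
  kernel pair of \<open>f\<close>. The restrictions in the action disappear because they are only
  evaluated on the fiber.\<close>

lemma homogeneous_iff:
  assumes "f \<in> qhom Q R" "f ` carrier Q = carrier R"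
  shows "homogeneous Q R f \<longleftrightarrow>
    (\<forall>x \<in> carrier Q. \<forall>y \<in> carrier Q. f x = f y \<longrightarrow> (\<exists>g \<in> Aut_rel Q f. y = g x))"
proof -
  have "transitive_action (Aut Q \<lparr>carrier := Aut_rel Q f\<rparr>) (fiber Q f q)
      (\<lambda>\<phi>. restrict \<phi> (fiber Q f q)) \<longleftrightarrow>
    (\<forall>x \<in> fiber Q f q. \<forall>y \<in> fiber Q f q. \<exists>g \<in> Aut_rel Q f. y = g x)" for q
  proof -
    have "transitive_action (Aut Q \<lparr>carrier := Aut_rel Q f\<rparr>) (fiber Q f q)
        (\<lambda>\<phi>. restrict \<phi> (fiber Q f q)) \<longleftrightarrow>
      (\<forall>x y. x \<in> fiber Q f q \<longrightarrow> y \<in> fiber Q f q \<longrightarrow>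
        (\<exists>g \<in> Aut_rel Q f. restrict g (fiber Q f q) x = y))"
      by (simp add: transitive_action_def transitive_action_axioms_def fiber_action)
    then show ?thesis by (simp add: Ball_def eq_commute)
  qed
  then have "homogeneous Q R f \<longleftrightarrow> (\<forall>q \<in> carrier R.
      \<forall>x \<in> fiber Q f q. \<forall>y \<in> fiber Q f q. \<exists>g \<in> Aut_rel Q f. y = g x)"
    using assms by (simp add: homogeneous_def)
  also have "\<dots> \<longleftrightarrow>
    (\<forall>x \<in> carrier Q. \<forall>y \<in> carrier Q. f x = f y \<longrightarrow> (\<exists>g \<in> Aut_rel Q f. y = g x))"
    unfolding assms(2)[symmetric] fiber_def by (simp add: eq_commute) blast
  finally show ?thesis .
qed

text \<open>Induction over words in the generators. A generator preserves the kernel pair because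
  \<open>f\<close> is a homomorphism, an inverse generator because left translations of
  \<open>R\<close> are injective.\<close>

lemma Inn_preserves_kernel_pair:
  assumes R: "quandle R" and f: "f \<in> qhom Q R" and "\<phi> \<in> Inn Q"
    and "x \<in> carrier Q" "y \<in> carrier Q" "f x = f y"
  shows "f (\<phi> x) = f (\<phi> y)"
  using assms(3-) unfolding Inn_def
proof (induction arbitrary: x y rule: generate.induct)
  case one
  then show ?case by (simp add: one_Aut)
next
  case (incl h)
  then show ?case using f by (auto simp: qhom_def)
next
  case (inv h)
  then obtain a where a: "a \<in> carrier Q" "h = (\<lambda>y \<in> carrier Q. a \<rhd> y)" by blast
  let ?i = "inv\<^bsub>Aut Q\<^esub> h"
  have h: "h \<in> qaut Q" using a inner_qaut by simp
  have i: "?i z \<in> carrier Q" "a \<rhd> ?i z = z" if "z \<in> carrier Q" for z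
    using inv_Aut_app(2,3)[OF h that] a(2) by simp_all
  have "f a \<rhd>\<^bsub>R\<^esub> f (?i z) = f z" if "z \<in> carrier Q" for z
    using f a(1) i[OF that] unfolding qhom_def by fastforce
  \<comment> \<open>Both sides are \<open>f x = f y\<close>; translation by \<open>f a\<close> can
    then be cancelled in \<open>R\<close>.\<close>
  then have "f a \<rhd>\<^bsub>R\<^esub> f (?i x) = f a \<rhd>\<^bsub>R\<^esub> f (?i y)" using inv by simp
  moreover have "inj_on (\<lambda>u. f a \<rhd>\<^bsub>R\<^esub> u) (carrier R)"
    using quandle.bij[OF R] f a(1) by (auto simp: qhom_def bij_betw_def)
  ultimately show ?case
    using f i inv.prems by (auto simp: qhom_def dest!: inj_onD)
next
  case (eng g h)
  have "g \<in> Inn Q" "h \<in> Inn Q" using eng.hyps by (simp_all add: Inn_def)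
  then have "g \<in> qaut Q" "h \<in> qaut Q" using subgroup.subset[OF subgroup_Inn] by auto
  \<comment> \<open>The hypothesis for \<open>g\<close> is applied to \<open>h x\<close> and
    \<open>h y\<close>, which is why the points are arbitrary in the induction.\<close>
  moreover from this have "f (g (h x)) = f (g (h y))"
    using eng.IH(1)[OF _ _ eng.IH(2)[OF eng.prems]] eng.prems(1,2) qaut_closed by blast
  ultimately show ?case using eng.prems(1,2) by (simp only: mult_Aut_app)
qed

text \<open>Let \<open>z\<close> be the preimage of \<open>x\<close> under \<open>\<phi>\<close>.
  Then \<open>g z\<close> and \<open>z\<close> have the same image under \<open>f\<close>, hence so
  do \<open>\<phi> (g z)\<close> and \<open>\<phi> z = x\<close>.\<close>

lemma normalized_Aut_rel:
  assumes "quandle R" "f \<in> qhom Q R"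
  shows "normalized_by_Inn Q (Aut_rel Q f)"
proof -
  interpret A: group "Aut Q" by (rule group_Aut)
  have "\<phi> \<otimes>\<^bsub>Aut Q\<^esub> g \<otimes>\<^bsub>Aut Q\<^esub> inv\<^bsub>Aut Q\<^esub> \<phi> \<in> Aut_rel Q f"
    if \<phi>: "\<phi> \<in> Inn Q" and g: "g \<in> Aut_rel Q f" for \<phi> g
  proof -
    have q: "\<phi> \<in> qaut Q" "g \<in> qaut Q" "inv\<^bsub>Aut Q\<^esub> \<phi> \<in> qaut Q" "\<phi> \<otimes>\<^bsub>Aut Q\<^esub> g \<in> qaut Q"
      "\<phi> \<otimes>\<^bsub>Aut Q\<^esub> g \<otimes>\<^bsub>Aut Q\<^esub> inv\<^bsub>Aut Q\<^esub> \<phi> \<in> qaut Q"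
      using \<phi> g subgroup.subset[OF subgroup_Inn] A.inv_closed[of \<phi>] A.m_closed[of \<phi> g]
        A.m_closed[of "\<phi> \<otimes>\<^bsub>Aut Q\<^esub> g" "inv\<^bsub>Aut Q\<^esub> \<phi>"] by (auto simp: Aut_rel_def)
    have "f (\<phi> (g ((inv\<^bsub>Aut Q\<^esub> \<phi>) x))) = f x" if x: "x \<in> carrier Q" for x
    proof -
      have i: "(inv\<^bsub>Aut Q\<^esub> \<phi>) x \<in> carrier Q" using q(3) x qaut_closed by blast
      then have "f (g ((inv\<^bsub>Aut Q\<^esub> \<phi>) x)) = f ((inv\<^bsub>Aut Q\<^esub> \<phi>) x)"
        using g by (simp add: Aut_rel_def)
      then have "f (\<phi> (g ((inv\<^bsub>Aut Q\<^esub> \<phi>) x))) = f (\<phi> ((inv\<^bsub>Aut Q\<^esub> \<phi>) x))"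
        using Inn_preserves_kernel_pair[OF assms \<phi>] q(2) i qaut_closed by blast
      then show ?thesis using inv_Aut_app(2)[OF q(1) x] by simp
    qed
    then show ?thesis using q by (simp add: Aut_rel_def mult_Aut_app qaut_closed)
  qed
  then show ?thesis unfolding normalized_by_Inn_def l_coset_def r_coset_def by blast
qed

text \<open>The kernel pair of \<open>quot_map Q G\<close> is the orbit relation of
  \<open>G\<close>, so this is a comparison of kernel pairs.\<close>

lemma iso_quot_iff:
  assumes "subgroup G (Aut Q)" "normalized_by_Inn Q G"
    and "f \<in> qhom Q R" "f ` carrier Q = carrier R"
  shows "iso_as_quotients Q f R (quot_map Q G) (quot Q G) \<longleftrightarrow>
    (\<forall>x \<in> carrier Q. \<forall>y \<in> carrier Q. f x = f y \<longleftrightarrow> (\<exists>g \<in> G. y = g x))"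
  using assms
  by (simp add: iso_as_quotients_iff quot_map_hom carrier_quot quot_map_cong_iff cong: ball_cong)

end

theorem proposition2p30:
  fixes P :: "('a, 'm) quandle_scheme" and Q :: "('b, 'n) quandle_scheme" and f :: "'a \<Rightarrow> 'b"
  assumes "quandle P" and "quandle Q"
    and "f \<in> qhom P Q" and "f ` carrier P = carrier Q"
  shows "homogeneous P Q f \<longleftrightarrow>
    (\<exists>G. subgroup G (Aut P) \<and> normalized_by_Inn P G \<and>
         iso_as_quotients P f Q (quot_map P G) (quot P G))"
proof -
  interpret P: quandle P by fact
  note hom_iff = P.homogeneous_iff[OF assms(3,4)]
  note iso_iff = P.iso_quot_iff[OF _ _ assms(3,4)]
  show ?thesis
  proof
    assume hom: "homogeneous P Q f"
    have "f x = f y \<longleftrightarrow> (\<exists>g \<in> Aut_rel P f. y = g x)"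
      if "x \<in> carrier P" "y \<in> carrier P" for x y
    proof
      show "f x = f y \<Longrightarrow> \<exists>g \<in> Aut_rel P f. y = g x"
        using hom that unfolding hom_iff by blast
      show "\<exists>g \<in> Aut_rel P f. y = g x \<Longrightarrow> f x = f y"
        using that by (auto simp: Aut_rel_def)
    qed
    then have "iso_as_quotients P f Q (quot_map P (Aut_rel P f)) (quot P (Aut_rel P f))"
      using iso_iff[OF P.subgroup_Aut_rel P.normalized_Aut_rel[OF assms(2,3)]] by blast
    then show "\<exists>G. subgroup G (Aut P) \<and> normalized_by_Inn P G \<and>
         iso_as_quotients P f Q (quot_map P G) (quot P G)"
      using P.subgroup_Aut_rel P.normalized_Aut_rel[OF assms(2,3)] by blast
  next
    assume "\<exists>G. subgroup G (Aut P) \<and> normalized_by_Inn P G \<and>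
         iso_as_quotients P f Q (quot_map P G) (quot P G)"
    then obtain G where G: "subgroup G (Aut P)"
      and ker: "\<And>x y. x \<in> carrier P \<Longrightarrow> y \<in> carrier P \<Longrightarrow> f x = f y \<longleftrightarrow> (\<exists>g \<in> G. y = g x)"
      by (auto simp: iso_iff)
    have "G \<subseteq> Aut_rel P f"
    proof
      fix g assume g: "g \<in> G"
      then have "g \<in> qaut P" using subgroup.subset[OF G] by auto
      \<comment> \<open>The points \<open>x\<close> and \<open>g x\<close> share a
        \<open>G\<close>-orbit, so \<open>ker\<close> applies with \<open>g\<close> itself as
        witness.\<close>
      moreover have "f (g x) = f x" if "x \<in> carrier P" for x
        using ker[OF that P.qaut_closed[OF \<open>g \<in> qaut P\<close> that]] g by auto
      ultimately show "g \<in> Aut_rel P f" by (simp add: Aut_rel_def)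
    qed
    then show "homogeneous P Q f" using ker by (auto simp: hom_iff)
  qed
qed

end
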